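(* Let $\{x_{i,k}\}$, $i\in\{1,\dots,m\}$, $k\ge 1$, be generated by the distributed proximal gradient algorithm described in the context, with arbitrary initial points $x_{i,1}\in\mathbb{R}^n$, and suppose that the problem assumptions (P-a)–(P-e) and the network assumptions (N-a)–(N-c) of the context hold. With $\bar x_k$, $g$, the error $\varepsilon_k$ ($k\ge2$), the $\varepsilon$-subdifferential $\partial_\varepsilon h$ and the functional $\mathrm{m}(\cdot)$ defined in the context, $$\lim_{k\to\infty}\mathrm{m}\big(\nabla g(\bar x_k)+\partial_{\varepsilon_k}h(\bar x_k)\big)=0.$$
   Context: **Problem.** There are $m$ agents. Consider $\min_{x\in\mathbb{R}^n} f(x)=\frac1m\sum_{i=1}^m\big(g_i(x)+h(x)\big)$, where $g_i:\mathbb{R}^n\to\mathbb{R}$ is differentiable (possibly non-convex) and $h:\mathbb{R}^n\to(-\infty,\infty]$ is closed, proper, convex and possibly non-smooth. $\|\cdot\|$ is the Euclidean norm. Write $g=\frac1m\sum_{i=1}^m g_i$. **Problem assumptions.** (P-a) Each $g_i$ is continuously differentiable and $\|\nabla g_i(x)-\nabla g_i(y)\|\le L\|x-y\|$ for all $x,y$, with a common constant $L>0$. (P-b) $h$ is convex. (P-c) There is a scalar $G_g$ with $\|\nabla g_i(x)\|<G_g$ for all $i$ and all $x$. (P-d) There is a scalar $G_h$ with $\|z\|<G_h$ for every $x$ and every subgradient $z\in\partial h(x)$. (P-e) The problem has at least one optimal solution $x^*$. **Network.** At each time $t=1,2,\dots$ the agents communicate over an undirected graph with vertex set $\{1,\dots,m\}$,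 edge set $\mathcal{E}(t)$ and symmetric adjacency (weight) matrix $A(t)=[a_{ij}(t)]\in\mathbb{R}^{m\times m}$. **Network assumptions.** (N-a) Each $A(t)$ is doubly stochastic. (N-b) There is $\eta\in(0,1)$ such that $a_{ii}(t)\ge\eta$ for all $i,t$; and for $i\neq j$, $a_{ij}(t)\ge\eta$ if $\{i,j\}\in\mathcal{E}(t)$ and $a_{ij}(t)=0$ otherwise. (N-c) The graph sequence is uniformly connected: each agent $j$ receives information from each agent $i$ for infinitely many $t$, and there is an integer $B\ge1$ such that each agent $i$ sends its information to all other agents at least once every $B$ consecutive time slots (i.e. for all $i\ne j$ and all $t$, $\{i,j\}\in\mathcal{E}(s)$ for some $s\in\{t,\dots,t+B-1\}$). **Proximal operator.** For $\alpha>0$, $\mathrm{prox}_{\alpha,h}(x)=\mathrm{argmin}_{z\in\mathbb{R}^n}\{h(z)+\frac{1}{2\alpha}\|z-x\|^2\}$. **Algorithm.** Fix a constant step-size $0<\alpha<\frac1L$. For $i\in\{1,\dots,m\}$ and $k=1,2,\dots$: $$q_{i,k+1}=x_{i,k}-\alpha\nabla g_i(x_{i,k}),\qquad v_{i,k+1}=\sum_{j=1}^m\lambda_{ij,k+1}\,q_{j,k+1},\qquad x_{i,k+1}=\mathrm{prox}_{\alpha,h}(v_{i,k+1}),$$ where $\lambda_{ij,k}=\big[\Phi(t(k)+k,t(k))\big]_{ij}$, $\Phi(t,s)=A(t)A(t-1)\cdots A(s+1)A(s)$ for $t>s\ge0$, and $t(k)$ is the total number of communication steps before iteration $k$; since $k$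 communication steps are performed at iteration $k$, $t(k)=\sum_{l=1}^{k-1}l=\frac{k(k-1)}2$. **Averages and errors.** $\bar x_k=\frac1m\sum_{i=1}^m x_{i,k}$, $\bar v_k=\frac1m\sum_{i=1}^m v_{i,k}$, $z_k=\mathrm{prox}_{\alpha,h}(\bar v_k)$, and for $k\ge1$ $$\varepsilon_{k+1}=\|\bar x_{k+1}-z_{k+1}\|\Big(G_h+\tfrac1\alpha\|z_{k+1}-\bar v_{k+1}\|\Big)+\tfrac1{2\alpha}\|\bar x_{k+1}-z_{k+1}\|^2 .$$ **Other notation.** For $\varepsilon\ge0$, the $\varepsilon$-subdifferential $\partial_\varepsilon h(x)$ is the set of vectors $y$ with $h(z)-h(x)\ge y'(z-x)-\varepsilon$ for all $z\in\mathbb{R}^n$. For a closed convex set $\mathcal{K}\subset\mathbb{R}^n$, $\mathrm{m}(\mathcal{K})=\min_{x\in\mathcal{K}}\|x\|$ (not to be confused with the number $m$ of agents). *)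

theory Defs
  imports "HOL-Analysis.Analysis"
begin

section \<open>Convex analysis\<close>

definition grad :: "('a::euclidean_space \<Rightarrow> real) \<Rightarrow> 'a \<Rightarrow> 'a" where
  "grad f x = (THE D. GDERIV f x :> D)"

definition continuously_differentiable :: "('a::euclidean_space \<Rightarrow> real) \<Rightarrow> bool" where
  "continuously_differentiable f \<longleftrightarrow>
     (\<forall>x. f differentiable (at x)) \<and> continuous_on UNIV (grad f)"

text \<open>The library's epigraph is restricted to real-valued functions. Points of the
  extended epigraph have a real second component.\<close>

definition ext_epigraph :: "('a \<Rightarrow> ereal) \<Rightarrow> ('a \<times> real) set" where
  "ext_epigraph h = {(x, r). h x \<le> ereal r}"

definition proper_fun :: "('a \<Rightarrow> ereal) \<Rightarrow> bool" where
  "proper_fun h \<longleftrightarrow> (\<forall>x. h x \<noteq> -\<infinity>) \<and> (\<exists>x. h x \<noteq> \<infinity>)"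

definition closed_fun :: "('a::euclidean_space \<Rightarrow> ereal) \<Rightarrow> bool" where
  "closed_fun h \<longleftrightarrow> closed (ext_epigraph h)"

definition convex_fun :: "('a::euclidean_space \<Rightarrow> ereal) \<Rightarrow> bool" where
  "convex_fun h \<longleftrightarrow> convex (ext_epigraph h)"

text \<open>The (sub)gradient inequalities are written without a difference of values of \<open>h\<close>,
  so that no \<open>\<infinity> - \<infinity>\<close> occurs; for proper \<open>h\<close> both sets are empty
  wherever \<open>h x = \<infinity>\<close>.\<close>

definition subdifferential :: "('a::euclidean_space \<Rightarrow> ereal) \<Rightarrow> 'a \<Rightarrow> 'a set" where
  "subdifferential h x = {y. \<forall>z. h x + ereal (y \<bullet> (z - x)) \<le> h z}"

definition eps_subdifferential :: "real \<Rightarrow> ('a::euclidean_space \<Rightarrow> ereal) \<Rightarrow> 'a \<Rightarrow> 'a set" where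
  "eps_subdifferential \<epsilon> h x = {y. \<forall>z. h x + ereal (y \<bullet> (z - x) - \<epsilon>) \<le> h z}"

definition prox :: "real \<Rightarrow> ('a::euclidean_space \<Rightarrow> ereal) \<Rightarrow> 'a \<Rightarrow> 'a" where
  "prox \<alpha> h x = (ARG_MIN (\<lambda>z. h z + ereal (1 / (2 * \<alpha>) * (norm (z - x))\<^sup>2)) z. True)"

text \<open>The minimum, not the infimum: the value is unspecified if no element of \<open>K\<close> has least
  norm, in particular if \<open>K\<close> is empty.\<close>

definition min_norm :: "'a::euclidean_space set \<Rightarrow> real" where
  "min_norm K = (LEAST r. r \<in> norm ` K)"


section \<open>The network\<close>

text \<open>Agents are the elements of a finite type \<open>'m\<close>. Communication takes place at times
  \<open>t \<ge> 1\<close>; the value of a time-indexed object at \<open>0\<close> plays no role.\<close>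

definition doubly_stochastic :: "real^'m^'m \<Rightarrow> bool" where
  "doubly_stochastic A \<longleftrightarrow>
     (\<forall>i j. A $ i $ j \<ge> 0) \<and> (\<forall>i. (\<Sum>j\<in>UNIV. A $ i $ j) = 1) \<and> (\<forall>j. (\<Sum>i\<in>UNIV. A $ i $ j) = 1)"

definition network_weights ::
    "real \<Rightarrow> (nat \<Rightarrow> 'm::finite set set) \<Rightarrow> (nat \<Rightarrow> real^'m^'m) \<Rightarrow> bool" where
  "network_weights \<eta> E A \<longleftrightarrow>
     (\<forall>t\<ge>1. (\<forall>i. A t $ i $ i \<ge> \<eta>) \<and>
            (\<forall>i j. i \<noteq> j \<longrightarrow>
               ({i, j} \<in> E t \<longrightarrow> A t $ i $ j \<ge> \<eta>) \<and> ({i, j} \<notin> E t \<longrightarrow> A t $ i $ j = 0)))"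

definition uniformly_connected :: "(nat \<Rightarrow> 'm set set) \<Rightarrow> bool" where
  "uniformly_connected E \<longleftrightarrow>
     (\<forall>i j. i \<noteq> j \<longrightarrow> infinite {t. t \<ge> 1 \<and> {i, j} \<in> E t}) \<and>
     (\<exists>B\<ge>1. \<forall>i j. i \<noteq> j \<longrightarrow> (\<forall>t\<ge>1. \<exists>s\<in>{t..t + B - 1}. {i, j} \<in> E s))"

text \<open>\<open>transition A t s\<close> is the product \<open>A t ** A (t - 1) ** \<dots> ** A s\<close> for \<open>t > s\<close>
  (and \<open>A s\<close> for \<open>t \<le> s\<close>, which is not used except for the recursion).\<close>

primrec transition :: "(nat \<Rightarrow> real^'m^'m) \<Rightarrow> nat \<Rightarrow> nat \<Rightarrow> real^'m^'m" where
  "transition A 0 s = A s"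
| "transition A (Suc t) s = (if s < Suc t then A (Suc t) ** transition A t s else A s)"

definition comm_steps :: "nat \<Rightarrow> nat" where
  "comm_steps k = (\<Sum>l = 1..<k. l)"

definition mixing :: "(nat \<Rightarrow> real^'m^'m) \<Rightarrow> nat \<Rightarrow> real^'m^'m" where
  "mixing A k = transition A (comm_steps k + k) (comm_steps k)"


section \<open>The distributed proximal gradient algorithm\<close>

definition agent_mean :: "('m::finite \<Rightarrow> 'a::real_vector) \<Rightarrow> 'a" where
  "agent_mean y = (1 / real CARD('m)) *\<^sub>R (\<Sum>i\<in>UNIV. y i)"

definition objective ::
    "('m::finite \<Rightarrow> 'a \<Rightarrow> real) \<Rightarrow> ('a \<Rightarrow> ereal) \<Rightarrow> 'a \<Rightarrow> ereal" where
  "objective g h x = ereal (1 / real CARD('m)) * (\<Sum>i\<in>UNIV. ereal (g i x) + h x)"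

text \<open>Iterates are indexed from \<open>1\<close>, intermediate points from \<open>2\<close>; the initial points
  \<open>x i 1\<close> are unconstrained.\<close>

definition dist_prox_gradient ::
    "real \<Rightarrow> (nat \<Rightarrow> real^'m^'m) \<Rightarrow> ('m::finite \<Rightarrow> 'a::euclidean_space \<Rightarrow> real) \<Rightarrow> ('a \<Rightarrow> ereal) \<Rightarrow>
     ('m \<Rightarrow> nat \<Rightarrow> 'a) \<Rightarrow> ('m \<Rightarrow> nat \<Rightarrow> 'a) \<Rightarrow> ('m \<Rightarrow> nat \<Rightarrow> 'a) \<Rightarrow> bool" where
  "dist_prox_gradient \<alpha> A g h x q v \<longleftrightarrow>
     (\<forall>i. \<forall>k\<ge>1.
        q i (k + 1) = x i k - \<alpha> *\<^sub>R grad (g i) (x i k) \<and>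
        v i (k + 1) = (\<Sum>j\<in>UNIV. mixing A (k + 1) $ i $ j *\<^sub>R q j (k + 1)) \<and>
        x i (k + 1) = prox \<alpha> h (v i (k + 1)))"

definition prox_error ::
    "real \<Rightarrow> real \<Rightarrow> ('a::euclidean_space \<Rightarrow> ereal) \<Rightarrow> 'a \<Rightarrow> 'a \<Rightarrow> real" where
  "prox_error \<alpha> Gh h xb vb =
     (let z = prox \<alpha> h vb
      in norm (xb - z) * (Gh + 1 / \<alpha> * norm (z - vb)) + 1 / (2 * \<alpha>) * (norm (xb - z))\<^sup>2)"

end

theory Submission
  imports Defs
begin

text \<open>Prox steps produce subgradients, \<open>(w - prox \<alpha> h w) / \<alpha> \<in> \<partial>h (prox \<alpha> h w)\<close>; bounding these for
  all step sizes \<open>\<alpha> \<rightarrow> 0\<close> shows that \<open>h\<close> is real-valued and Lipschitz. The averaging matrices tend to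
  the uniform matrix geometrically while the iterates grow at most linearly, so the disagreement of
  the agents is summable. Hence the mean iterate follows a proximal gradient step on \<open>g + h\<close> up to a
  summable error. As \<open>L < 1 / \<alpha>\<close> and \<open>g + h\<close> is bounded below, the squared step lengths are summable,
  and the residual \<open>\<nabla>g (xbar k) + (vbar k - z k) / \<alpha>\<close>, which lies in the set in question,
  tends to \<open>0\<close>.\<close>

section \<open>Proximal operators of functions with bounded subgradients\<close>

lemma ext_epigraph_iff: "(x, r) \<in> ext_epigraph h \<longleftrightarrow> h x \<le> ereal r"
  by (simp add: ext_epigraph_def)

text \<open>Separation of the epigraph from the point one unit below its boundary at
  \<open>x0\<close>. The epigraph point \<open>(x0, r0)\<close> straight above forces the vertical
  coefficient \<open>b\<close> to be positive, so the hyperplane is the graph of an affine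
  function.\<close>

lemma closed_convex_proper_affine_minorant:
  fixes h :: "'a::euclidean_space \<Rightarrow> ereal"
  assumes "closed_fun h" "convex_fun h" "proper_fun h"
  shows "\<exists>a c. \<forall>z r. h z \<le> ereal r \<longrightarrow> c - a \<bullet> z \<le> r"
proof -
  obtain x0 where "h x0 \<noteq> \<infinity>" "h x0 \<noteq> -\<infinity>"
    using assms(3) by (auto simp: proper_fun_def)
  then obtain r0 where r0: "h x0 = ereal r0" by (cases "h x0") auto
  have "(x0, r0 - 1) \<notin> ext_epigraph h" using r0 by (simp add: ext_epigraph_iff)
  moreover have "closed (ext_epigraph h)" "convex (ext_epigraph h)"
    using assms by (simp_all add: closed_fun_def convex_fun_def)
  ultimately obtain ab c where
    sep: "ab \<bullet> (x0, r0 - 1) < c" "\<forall>p\<in>ext_epigraph h. ab \<bullet> p > c"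
    using separating_hyperplane_closed_point[of "ext_epigraph h" "(x0, r0 - 1)"] by blast
  obtain a b where ab: "ab = (a, b)" by (cases ab)
  have "(x0, r0) \<in> ext_epigraph h" using r0 by (simp add: ext_epigraph_iff)
  then have "a \<bullet> x0 + b * r0 > c" using sep(2) ab by fastforce
  then have b: "b > 0" using sep(1) ab by (simp add: algebra_simps)
  have "c / b - (a /\<^sub>R b) \<bullet> z \<le> r" if "h z \<le> ereal r" for z r
  proof -
    from that have "(z, r) \<in> ext_epigraph h" by (simp add: ext_epigraph_iff)
    then have "a \<bullet> z + b * r > c" using sep(2) ab by fastforce
    then show ?thesis using b by (simp add: field_simps)
  qed
  then show ?thesis by blast
qed

text \<open>Shows that the choice behind \<open>ARG_MIN\<close> has a witness. An affine minorant of
  \<open>h\<close> loses against the quadratic term, so a sublevel set is compact.\<close>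

lemma prox_exists:
  fixes h :: "'a::euclidean_space \<Rightarrow> ereal"
  assumes "closed_fun h" "convex_fun h" "proper_fun h" "\<alpha> > 0"
  shows "is_arg_min (\<lambda>z. h z + ereal (1 / (2 * \<alpha>) * (norm (z - w))\<^sup>2)) (\<lambda>_. True) (prox \<alpha> h w)"
proof -
  \<comment> \<open>Minimizing over epigraph points instead of over \<open>z\<close> makes the
    objective real-valued and continuous; closedness of \<open>h\<close> becomes closedness of the
    feasible set.\<close>
  define F where "F p = snd p + 1 / (2 * \<alpha>) * (norm (fst p - w))\<^sup>2" for p :: "'a \<times> real"
  obtain a c where ac: "\<And>z r. h z \<le> ereal r \<Longrightarrow> c - a \<bullet> z \<le> r"
    using closed_convex_proper_affine_minorant[OF assms(1-3)] by blast
  obtain x0 where "h x0 \<noteq> \<infinity>" "h x0 \<noteq> -\<infinity>"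
    using assms(3) by (auto simp: proper_fun_def)
  then obtain r0 where r0: "h x0 = ereal r0" by (cases "h x0") auto
  define K where "K = ext_epigraph h \<inter> {p. F p \<le> F (x0, r0)}"
  have contF: "continuous_on S F" for S unfolding F_def by (intro continuous_intros)
  have "closed {p. F p \<le> F (x0, r0)}"
    by (intro closed_Collect_le contF continuous_on_const)
  then have "closed K" unfolding K_def
    using assms(1) by (simp add: closed_fun_def closed_Int)
  moreover have "bounded K"
  proof -
    define M where "M = F (x0, r0)"
    define N where "N = norm a"
    define D where "D = M - c + N * norm w"
    \<comment> \<open>On \<open>K\<close> the distance \<open>u\<close> from \<open>w\<close>
      satisfies \<open>u\<^sup>2 \<le> 2 * \<alpha> * (D + N * u)\<close>. For
      \<open>u > R \<ge> 1\<close> the right-hand side is at most \<open>(R - 1) * u\<close>, a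
      contradiction.\<close>
    define R where "R = 1 + 2 * \<alpha> * (\<bar>D\<bar> + N)"
    have "norm (fst p) \<le> R + norm w \<and> \<bar>snd p\<bar> \<le> \<bar>c\<bar> + N * (R + norm w) + \<bar>M\<bar>"
      if "p \<in> K" for p
    proof -
      obtain z r where p: "p = (z, r)" by (cases p)
      have lo: "c - a \<bullet> z \<le> r" and hi: "r + 1 / (2 * \<alpha>) * (norm (z - w))\<^sup>2 \<le> M"
        using that ac by (auto simp: K_def p F_def M_def ext_epigraph_iff)
      define u where "u = norm (z - w)"
      have u0: "u \<ge> 0" and N0: "N \<ge> 0" by (auto simp: u_def N_def)
      have az: "a \<bullet> z \<le> N * norm z" unfolding N_def by (rule norm_cauchy_schwarz)
      have zu: "norm z \<le> u + norm w" unfolding u_def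
        using norm_triangle_ineq[of "z - w" w] by simp
      have Nz: "N * norm z \<le> N * (u + norm w)" by (rule mult_left_mono[OF zu N0])
      have "1 / (2 * \<alpha>) * u\<^sup>2 \<le> D + N * u"
        using lo hi az Nz by (simp add: D_def u_def algebra_simps)
      then have q: "u\<^sup>2 \<le> 2 * \<alpha> * (D + N * u)" using assms(4) by (simp add: field_simps)
      have uR: "u \<le> R"
      proof (rule ccontr)
        assume "\<not> u \<le> R"
        then have u: "u > R" by simp
        have R1: "R \<ge> 1" unfolding R_def using assms(4) N0 by simp
        have "D + N * u \<le> (\<bar>D\<bar> + N) * u"
        proof -
          have "\<bar>D\<bar> * 1 \<le> \<bar>D\<bar> * u" using u R1 by (intro mult_left_mono) auto
          then show ?thesis by (simp add: algebra_simps)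
        qed
        then have "u\<^sup>2 \<le> (2 * \<alpha> * (\<bar>D\<bar> + N)) * u"
          using q assms(4) by (smt (verit) mult.assoc mult_left_mono)
        then have "u * u \<le> (R - 1) * u" by (simp add: R_def power2_eq_square)
        then have "u \<le> R - 1" using u R1 by (smt (verit) mult_le_cancel_right)
        then show False using u by simp
      qed
      have zb: "norm z \<le> R + norm w" using zu uR by simp
      have "N * norm z \<le> N * (R + norm w)" by (rule mult_left_mono[OF zb N0])
      moreover have "1 / (2 * \<alpha>) * (norm (z - w))\<^sup>2 \<ge> 0" using assms(4) by simp
      ultimately have "\<bar>r\<bar> \<le> \<bar>c\<bar> + N * (R + norm w) + \<bar>M\<bar>"
        using lo hi az mult_nonneg_nonneg[OF N0 norm_ge_zero[of z]] by linarith
      then show ?thesis using zb by (simp add: p)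
    qed
    then have "norm p \<le> (R + norm w) + (\<bar>c\<bar> + N * (R + norm w) + \<bar>M\<bar>)" if "p \<in> K" for p
      using that norm_fst_le[of "fst p" "snd p"] norm_triangle_ineq[of "(fst p, 0)" "(0, snd p)"]
      by (fastforce simp: norm_Pair)
    then show ?thesis by (meson boundedI)
  qed
  ultimately have "compact K" by (simp add: compact_eq_bounded_closed)
  moreover have K0: "(x0, r0) \<in> K" using r0 by (simp add: K_def ext_epigraph_iff)
  ultimately obtain p where p: "p \<in> K" "\<forall>y\<in>K. F p \<le> F y"
    using continuous_attains_inf[OF _ _ contF, of K] by blast
  have pmin: "F p \<le> F y" if "y \<in> ext_epigraph h" for y
    using that p K0 unfolding K_def by (smt (verit) Int_iff mem_Collect_eq)
  obtain z0 s0 where zs: "p = (z0, s0)" by (cases p)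
  have zs0: "h z0 \<le> ereal s0" using p(1) by (simp add: K_def zs ext_epigraph_iff)
  have "is_arg_min (\<lambda>z. h z + ereal (1 / (2 * \<alpha>) * (norm (z - w))\<^sup>2)) (\<lambda>_. True) z0"
  proof -
    have "h z0 + ereal (1 / (2 * \<alpha>) * (norm (z0 - w))\<^sup>2) \<le> h z + ereal (1 / (2 * \<alpha>) * (norm (z - w))\<^sup>2)" for z
    proof (cases "h z")
      case (real r)
      have "s0 + 1 / (2 * \<alpha>) * (norm (z0 - w))\<^sup>2 \<le> r + 1 / (2 * \<alpha>) * (norm (z - w))\<^sup>2"
        using pmin[of "(z, r)"] real by (simp add: F_def zs ext_epigraph_iff)
      then have "ereal s0 + ereal (1 / (2 * \<alpha>) * (norm (z0 - w))\<^sup>2)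
          \<le> ereal r + ereal (1 / (2 * \<alpha>) * (norm (z - w))\<^sup>2)" by simp
      then show ?thesis unfolding real using zs0 by (meson add_right_mono order_trans)
    next
      case MInf then show ?thesis using assms(3) by (simp add: proper_fun_def)
    qed simp
    then show ?thesis by (auto simp: is_arg_min_def not_less)
  qed
  then show ?thesis unfolding prox_def arg_min_def by (rule someI)
qed

text \<open>First-order optimality: minimality of \<open>p\<close> is tested along the segment
  towards \<open>z\<close>, where convexity bounds \<open>h\<close> linearly and the quadratic term
  contributes its derivative plus an error of second order in \<open>t\<close>.\<close>

lemma prox_subgradient:
  fixes h :: "'a::euclidean_space \<Rightarrow> ereal"
  assumes "closed_fun h" "convex_fun h" "proper_fun h" "\<alpha> > 0"
  shows "(1 / \<alpha>) *\<^sub>R (w - prox \<alpha> h w) \<in> subdifferential h (prox \<alpha> h w)"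
proof -
  define p where "p = prox \<alpha> h w"
  define Q where "Q z = 1 / (2 * \<alpha>) * (norm (z - w))\<^sup>2" for z
  have min: "h p + ereal (Q p) \<le> h z + ereal (Q z)" for z
    using prox_exists[OF assms, of w] by (auto simp: is_arg_min_def not_less p_def Q_def)
  obtain x0 where x0: "h x0 \<noteq> \<infinity>" "h x0 \<noteq> -\<infinity>"
    using assms(3) by (auto simp: proper_fun_def)
  then have "h p \<noteq> \<infinity>" using min[of x0] by (cases "h x0") auto
  moreover have "h p \<noteq> -\<infinity>" using assms(3) by (auto simp: proper_fun_def)
  ultimately obtain s where s: "h p = ereal s" by (cases "h p") auto
  have "h p + ereal (((1 / \<alpha>) *\<^sub>R (w - p)) \<bullet> (z - p)) \<le> h z" for z
  proof (cases "h z")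
    case (real r)
    define Z where "Z = (norm (z - p))\<^sup>2 / (2 * \<alpha>)"
    have step: "s + (1 / \<alpha>) * ((w - p) \<bullet> (z - p)) \<le> r + t * Z" if t: "0 < t" "t < 1" for t
    proof -
      have "(1 - t) *\<^sub>R (p, s) + t *\<^sub>R (z, r) \<in> ext_epigraph h"
        using assms(2) t s real unfolding convex_fun_def
        by (intro convexD) (auto simp: ext_epigraph_iff)
      then have "h (p + t *\<^sub>R (z - p)) \<le> ereal (s + t * (r - s))"
        by (simp add: ext_epigraph_iff algebra_simps)
      then have "ereal (s + Q p) \<le> ereal (s + t * (r - s) + Q (p + t *\<^sub>R (z - p)))"
        using min[of "p + t *\<^sub>R (z - p)"] unfolding s
        by (metis add_right_mono order_trans plus_ereal.simps(1))
      moreover have "Q (p + t *\<^sub>R (z - p)) = Q p - t * ((1 / \<alpha>) * ((w - p) \<bullet> (z - p))) + t * (t * Z)"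
      proof -
        have "(norm (p + t *\<^sub>R (z - p) - w))\<^sup>2 = (norm (t *\<^sub>R (z - p) - (w - p)))\<^sup>2"
          by (simp add: algebra_simps)
        also have "\<dots> = t\<^sup>2 * (norm (z - p))\<^sup>2 - 2 * t * ((w - p) \<bullet> (z - p)) + (norm (p - w))\<^sup>2"
          unfolding norm_minus_commute[of p] power2_norm_eq_inner
          by (simp add: inner_diff_left[of "_ *\<^sub>R _"] inner_diff_right[of _ "_ *\<^sub>R _"]
                power2_eq_square inner_commute[of "z - p" "w - p"] right_diff_distrib)
        finally show ?thesis using assms(4)
          by (simp add: Q_def Z_def field_simps power2_eq_square)
      qed
      ultimately have "t * (s + (1 / \<alpha>) * ((w - p) \<bullet> (z - p))) \<le> t * (r + t * Z)"
        by (simp add: algebra_simps)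
      then show ?thesis using t by simp
    qed
    \<comment> \<open>After division by \<open>t\<close> the remaining error \<open>t * Z\<close>
      vanishes as \<open>t\<close> decreases to 0.\<close>
    have "((\<lambda>t. r + t * Z) \<longlongrightarrow> r + 0 * Z) (at_right 0)" by (intro tendsto_intros)
    moreover have "\<forall>\<^sub>F t in at_right 0. s + (1 / \<alpha>) * ((w - p) \<bullet> (z - p)) \<le> r + t * Z"
      unfolding eventually_at_right_field using step by (intro exI[of _ 1]) auto
    ultimately have "s + (1 / \<alpha>) * ((w - p) \<bullet> (z - p)) \<le> r + 0 * Z"
      by (rule tendsto_lowerbound) simp
    then show ?thesis by (simp add: s real)
  next
    case MInf then show ?thesis using assms(3) by (simp add: proper_fun_def)
  qed simp
  then show ?thesis by (simp add: subdifferential_def p_def)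
qed

text \<open>It is not known beforehand that \<open>h\<close> has a subgradient at a given
  \<open>w\<close>, but proximal points carry subgradients and approach \<open>w\<close> as the step
  size shrinks. The subgradient inequality there passes to the limit because the epigraph is closed.
  From here on \<open>h\<close> can be replaced by a real function \<open>H\<close>.\<close>

lemma bounded_subgradients_imp_Lipschitz:
  fixes h :: "'a::euclidean_space \<Rightarrow> ereal"
  assumes "closed_fun h" "convex_fun h" "proper_fun h"
    and G: "\<And>y z. z \<in> subdifferential h y \<Longrightarrow> norm z < G"
  obtains H where "h = (\<lambda>x. ereal (H x))" "\<And>x y. \<bar>H x - H y\<bar> \<le> G * norm (x - y)"
proof -
  have bound: "h w \<le> ereal (r + G * norm (z - w))" if r: "h z \<le> ereal r" for w z r
  proof -
    define p where "p n = prox (inverse (real (Suc n))) h w" for n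
    have sub: "(1 / inverse (real (Suc n))) *\<^sub>R (w - p n) \<in> subdifferential h (p n)" for n
      unfolding p_def by (rule prox_subgradient[OF assms(1-3)]) simp
    \<comment> \<open>The displacement is the step size times a subgradient of norm below
      \<open>G\<close>.\<close>
    have "norm (p n - w) \<le> G * inverse (real (Suc n))" for n
      using G[OF sub[of n]] by (simp add: divide_simps norm_minus_commute) (simp add: algebra_simps)
    moreover have "(\<lambda>n. G * inverse (real (Suc n))) \<longlonglongrightarrow> G * 0"
      by (intro tendsto_intros LIMSEQ_inverse_real_of_nat)
    ultimately have "(\<lambda>n. p n - w) \<longlonglongrightarrow> 0"
      using Lim_null_comparison[of "\<lambda>n. p n - w" "\<lambda>n. G * inverse (real (Suc n))" sequentially]
      by (simp del: of_nat_Suc)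
    then have lim: "p \<longlonglongrightarrow> w" using LIM_zero_cancel by blast
    have "h (p n) \<le> ereal (r + G * norm (z - p n))" for n
    proof -
      define y where "y = (1 / inverse (real (Suc n))) *\<^sub>R (w - p n)"
      have "h (p n) + ereal (y \<bullet> (z - p n)) \<le> ereal r"
        using sub[of n] r unfolding subdifferential_def y_def by (blast intro: order_trans)
      moreover have "\<bar>y \<bullet> (z - p n)\<bar> \<le> G * norm (z - p n)"
        using Cauchy_Schwarz_ineq2[of y "z - p n"] G[OF sub[of n]] unfolding y_def[symmetric]
        by (smt (verit) mult_right_mono norm_ge_zero)
      ultimately show ?thesis by (cases "h (p n)") auto
    qed
    then have "\<forall>n. (p n, r + G * norm (z - p n)) \<in> ext_epigraph h"
      by (simp add: ext_epigraph_iff)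
    moreover have "(\<lambda>n. (p n, r + G * norm (z - p n))) \<longlonglongrightarrow> (w, r + G * norm (z - w))"
      by (intro tendsto_intros lim)
    ultimately have "(w, r + G * norm (z - w)) \<in> ext_epigraph h"
      using closed_sequentially[OF assms(1)[unfolded closed_fun_def],
          of "\<lambda>n. (p n, r + G * norm (z - p n))"] by simp
    then show ?thesis by (simp add: ext_epigraph_iff)
  qed
  obtain x0 where x0: "h x0 \<noteq> \<infinity>" "h x0 \<noteq> -\<infinity>"
    using assms(3) by (auto simp: proper_fun_def)
  then obtain r0 where "h x0 = ereal r0" by (cases "h x0") auto
  \<comment> \<open>The single finite value at \<open>x0\<close> bounds \<open>h\<close> from above
    everywhere.\<close>
  then have fin: "h w = ereal (real_of_ereal (h w))" for w
    using bound[of x0 r0 w] assms(3) by (cases "h w") (auto simp: proper_fun_def)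
  define H where "H w = real_of_ereal (h w)" for w
  have H: "h w = ereal (H w)" for w using fin by (simp add: H_def)
  have le: "H w - H z \<le> G * norm (w - z)" for w z
    using bound[of z "H z" w] by (simp add: H norm_minus_commute)
  show thesis
  proof (rule that)
    show "h = (\<lambda>x. ereal (H x))" using H by auto
    show "\<bar>H x - H y\<bar> \<le> G * norm (x - y)" for x y
      using le[of x y] le[of y x] by (simp add: norm_minus_commute abs_le_iff)
  qed
qed

text \<open>Monotonicity of the subdifferential: the two subgradient inequalities, each tested at
  the other proximal point, are added; Cauchy-Schwarz finishes.\<close>

lemma prox_nonexpansive:
  fixes H :: "'a::euclidean_space \<Rightarrow> real"
  assumes "h = (\<lambda>x. ereal (H x))" "\<alpha> > 0"
    and sub: "\<And>w. (1 / \<alpha>) *\<^sub>R (w - prox \<alpha> h w) \<in> subdifferential h (prox \<alpha> h w)"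
  shows "norm (prox \<alpha> h u - prox \<alpha> h w) \<le> norm (u - w)"
proof -
  define p where "p = prox \<alpha> h u"
  define q where "q = prox \<alpha> h w"
  have "H p + (1 / \<alpha>) * ((u - p) \<bullet> (q - p)) \<le> H q" "H q + (1 / \<alpha>) * ((w - q) \<bullet> (p - q)) \<le> H p"
    using sub[of u] sub[of w] by (auto simp: subdifferential_def assms(1) p_def q_def)
  then have "(1 / \<alpha>) * ((u - p) \<bullet> (q - p) + (w - q) \<bullet> (p - q)) \<le> 0"
    by (simp add: algebra_simps)
  then have "(u - p) \<bullet> (q - p) + (w - q) \<bullet> (p - q) \<le> 0"
    using assms(2) by (simp add: divide_le_0_iff)
  then have "norm (p - q) * norm (p - q) \<le> (u - w) \<bullet> (p - q)"
    unfolding power2_eq_square[symmetric] power2_norm_eq_inner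
    by (simp add: algebra_simps inner_diff_left inner_diff_right inner_commute)
  also have "\<dots> \<le> norm (u - w) * norm (p - q)" by (rule norm_cauchy_schwarz)
  finally show ?thesis
    unfolding p_def[symmetric] q_def[symmetric]
    by (cases "p = q") auto
qed

text \<open>A subgradient at the exact proximal point is an \<open>\<epsilon>\<close>-subgradient at a nearby point, because
  \<open>h\<close> is Lipschitz.\<close>

lemma prox_eps_subgradient:
  fixes H :: "'a::euclidean_space \<Rightarrow> real"
  assumes "h = (\<lambda>x. ereal (H x))" "\<alpha> > 0"
    and sub: "(1 / \<alpha>) *\<^sub>R (w - prox \<alpha> h w) \<in> subdifferential h (prox \<alpha> h w)"
    and Lip: "\<And>x y. \<bar>H x - H y\<bar> \<le> G * norm (x - y)"
  shows "(1 / \<alpha>) *\<^sub>R (w - prox \<alpha> h w) \<in> eps_subdifferential (prox_error \<alpha> G h x w) h x"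
proof -
  define p where "p = prox \<alpha> h w"
  define y where "y = (1 / \<alpha>) *\<^sub>R (w - p)"
  have "H x + (y \<bullet> (z - x) - prox_error \<alpha> G h x w) \<le> H z" for z
  proof -
    have "H p + y \<bullet> (z - p) \<le> H z"
      using sub by (auto simp: subdifferential_def assms(1) p_def y_def)
    moreover have "y \<bullet> (z - p) = y \<bullet> (z - x) + y \<bullet> (x - p)" by (simp add: inner_diff_right)
    \<comment> \<open>Moving the base point from \<open>p\<close> to \<open>x\<close> costs this
      amount in \<open>H\<close> and \<open>norm y * norm (x - p)\<close> in the linear term;
      together they form the first summand of \<open>prox_error\<close>.\<close>
    moreover have "H x - H p \<le> G * norm (x - p)" using Lip[of x p] by simp
    moreover have "- (y \<bullet> (x - p)) \<le> norm y * norm (x - p)"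
      using Cauchy_Schwarz_ineq2[of y "x - p"] by simp
    moreover have "norm y = 1 / \<alpha> * norm (p - w)"
      using assms(2) by (simp add: y_def norm_minus_commute)
    moreover have "0 \<le> 1 / (2 * \<alpha>) * (norm (x - p))\<^sup>2" using assms(2) by simp
    ultimately show ?thesis
      by (simp add: prox_error_def Let_def p_def[symmetric] algebra_simps)
  qed
  then show ?thesis by (simp add: eps_subdifferential_def assms(1) p_def y_def)
qed

section \<open>Attainment of least norms and closedness of
  \<open>\<epsilon>\<close>-subdifferentials\<close>

text \<open>A nonempty closed set in a Euclidean space has a point nearest to 0, so the
  \<open>LEAST\<close> in \<open>min_norm\<close> denotes an actual norm.\<close>

lemma min_norm_le:
  fixes K :: "'a::euclidean_space set"
  assumes "closed K" "y \<in> K"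
  shows "0 \<le> min_norm K" "min_norm K \<le> norm y"
proof -
  obtain x where x: "x \<in> K" "\<forall>z\<in>K. dist 0 x \<le> dist 0 z"
    using assms by (metis distance_attains_inf empty_iff)
  have "min_norm K = norm x"
    unfolding min_norm_def using x by (intro Least_equality) auto
  then show "0 \<le> min_norm K" "min_norm K \<le> norm y" using x assms by auto
qed

text \<open>Each \<open>z\<close> imposes a closed half-space on \<open>y\<close>.\<close>

lemma closed_eps_subdifferential:
  assumes "h = (\<lambda>x. ereal (H x))"
  shows "closed (eps_subdifferential \<epsilon> h x)"
proof -
  have *: "H x + (y \<bullet> (z - x) - \<epsilon>) \<le> H z \<longleftrightarrow> (z - x) \<bullet> y \<le> H z - H x + \<epsilon>" for y z
    unfolding inner_commute[of y] by linarith
  have "eps_subdifferential \<epsilon> h x = {y. \<forall>z. (z - x) \<bullet> y \<le> H z - H x + \<epsilon>}"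
    by (simp only: eps_subdifferential_def assms plus_ereal.simps ereal_less_eq *)
  also have "\<dots> = (\<Inter>z. {y. (z - x) \<bullet> y \<le> H z - H x + \<epsilon>})"
    by (rule Collect_all_eq)
  finally show ?thesis by (simp add: closed_INT closed_halfspace_le)
qed

section \<open>Gradients\<close>

lemma GDERIV_unique:
  fixes f :: "'a::euclidean_space \<Rightarrow> real"
  assumes "GDERIV f x :> D" "GDERIV f x :> E"
  shows "D = E"
proof -
  have "(\<lambda>u. u \<bullet> D) = (\<lambda>u. u \<bullet> E)"
    using assms has_derivative_unique unfolding gderiv_def by blast
  then have "(D - E) \<bullet> D = (D - E) \<bullet> E" by metis
  then have "(D - E) \<bullet> (D - E) = 0" by (simp add: inner_diff_right)
  then show ?thesis by simp
qed

text \<open>The derivative is represented by a vector through its adjoint at 1, and uniqueness of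
  that vector validates the \<open>THE\<close> in \<open>grad\<close>.\<close>

lemma GDERIV_grad:
  fixes f :: "'a::euclidean_space \<Rightarrow> real"
  assumes "f differentiable (at x)"
  shows "GDERIV f x :> grad f x"
proof -
  obtain f' where f': "(f has_derivative f') (at x)" using assms by (auto simp: differentiable_def)
  have "f' = (\<lambda>u. u \<bullet> adjoint f' 1)"
    using adjoint_works[OF has_derivative_linear[OF f'], of _ 1] by auto
  then have "GDERIV f x :> adjoint f' 1" using f' by (simp add: gderiv_def)
  then show ?thesis unfolding grad_def by (metis GDERIV_unique theI)
qed

lemma grad_eqI:
  fixes f :: "'a::euclidean_space \<Rightarrow> real"
  assumes "GDERIV f x :> D"
  shows "grad f x = D"
proof -
  have "GDERIV f x :> grad f x"
    using assms by (intro GDERIV_grad) (auto simp: gderiv_def differentiable_def)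
  then show ?thesis using assms GDERIV_unique by blast
qed

lemma gradient_mean_value:
  fixes f :: "'a::euclidean_space \<Rightarrow> real"
  assumes "\<And>x. GDERIV f x :> D x"
  obtains t where "0 < t" "t < 1" "f y - f x = (y - x) \<bullet> D (x + t *\<^sub>R (y - x))"
proof -
  have "((\<lambda>t. f (x + t *\<^sub>R (y - x))) has_real_derivative (y - x) \<bullet> D (x + t *\<^sub>R (y - x))) (at t)" for t
  proof -
    have 1: "((\<lambda>t. x + t *\<^sub>R (y - x)) has_derivative (\<lambda>s. s *\<^sub>R (y - x))) (at t)"
      by (auto intro!: derivative_eq_intros)
    have 2: "(f has_derivative (\<lambda>u. u \<bullet> D (x + t *\<^sub>R (y - x)))) (at (x + t *\<^sub>R (y - x)))"
      using assms by (simp add: gderiv_def)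
    show ?thesis
      using has_derivative_compose[OF 1 2] by (simp add: has_field_derivative_def mult.commute[of _ "_ \<bullet> _"])
  qed
  from MVT2[of 0 1 "\<lambda>t. f (x + t *\<^sub>R (y - x))", OF _ this]
  obtain t where "0 < t" "t < 1" "f y - f x = (y - x) \<bullet> D (x + t *\<^sub>R (y - x))" by auto
  then show thesis by (rule that)
qed

text \<open>The mean value theorem yields the constant \<open>L\<close> rather than the sharper
  \<open>L / 2\<close>; this suffices because the step size satisfies
  \<open>L < 1 / \<alpha>\<close>.\<close>

lemma Lipschitz_gradient_upper_bound:
  fixes f :: "'a::euclidean_space \<Rightarrow> real"
  assumes "\<And>x. GDERIV f x :> D x" and Lip: "\<And>x y. norm (D x - D y) \<le> L * norm (x - y)" and "L \<ge> 0"
  shows "f y \<le> f x + D x \<bullet> (y - x) + L * (norm (y - x))\<^sup>2"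
proof -
  obtain t where t: "0 < t" "t < 1" "f y - f x = (y - x) \<bullet> D (x + t *\<^sub>R (y - x))"
    using gradient_mean_value[OF assms(1)] by blast
  define u where "u = x + t *\<^sub>R (y - x)"
  have "norm (D u - D x) \<le> L * norm (y - x)"
  proof -
    have "norm (D u - D x) \<le> L * (t * norm (y - x))" using Lip[of u x] t by (simp add: u_def)
    also have "\<dots> \<le> L * norm (y - x)"
      using t \<open>L \<ge> 0\<close> by (intro mult_left_mono) (auto intro: mult_left_le_one_le)
    finally show ?thesis .
  qed
  then have "(y - x) \<bullet> (D u - D x) \<le> norm (y - x) * (L * norm (y - x))"
    by (meson norm_cauchy_schwarz mult_left_mono norm_ge_zero order_trans)
  then show ?thesis
    using t(3) unfolding u_def[symmetric] by (simp add: inner_diff_right power2_eq_square inner_commute algebra_simps)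
qed

lemma bounded_gradient_imp_Lipschitz:
  fixes f :: "'a::euclidean_space \<Rightarrow> real"
  assumes "\<And>x. GDERIV f x :> D x" "\<And>x. norm (D x) \<le> G"
  shows "f y - f x \<le> G * norm (y - x)"
proof -
  obtain t where "f y - f x = (y - x) \<bullet> D (x + t *\<^sub>R (y - x))"
    using gradient_mean_value[OF assms(1)] by blast
  also have "\<dots> \<le> norm (y - x) * G"
    by (meson assms(2) norm_cauchy_schwarz mult_left_mono norm_ge_zero order_trans)
  finally show ?thesis by (simp add: mult.commute)
qed

section \<open>Inexact proximal gradient steps\<close>

text \<open>Telescoping bounds the partial sums of \<open>d\<close> by \<open>F 0 - l\<close> plus
  the total perturbation.\<close>

lemma descent_imp_null_sequence:
  fixes F d s :: "nat \<Rightarrow> real"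
  assumes "\<And>n. F (Suc n) \<le> F n - d n + s n" "\<And>n. 0 \<le> d n" "\<And>n. 0 \<le> s n"
    and "summable s" "\<And>n. l \<le> F n"
  shows "d \<longlonglongrightarrow> 0"
proof -
  have "(\<Sum>k<n. d k) \<le> F 0 - F n + (\<Sum>k<n. s k)" for n
  proof (induction n)
    case (Suc n)
    then show ?case using assms(1)[of n] by simp
  qed simp
  moreover have "(\<Sum>k<n. s k) \<le> suminf s" for n
    using assms(3,4) by (intro sum_le_suminf) auto
  ultimately have "(\<Sum>k<n. d k) \<le> F 0 - l + suminf s" for n
    using assms(5)[of n] by (meson add_mono diff_left_mono order_refl order_trans)
  then have "summable d" by (rule summableI_nonneg_bounded[OF assms(2)])
  then show ?thesis by (rule summable_LIMSEQ_zero)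
qed

text \<open>Here \<open>e\<close> is the error of the gradient used in the step. The subgradient
  inequality at \<open>p\<close>, tested at \<open>x\<close>, gains \<open>1 / \<alpha>\<close>
  times the squared step; the upper bound on \<open>f\<close> gives back \<open>L\<close> times
  it.\<close>

lemma prox_gradient_descent:
  fixes f H :: "'a::euclidean_space \<Rightarrow> real"
  assumes grad: "\<And>x. GDERIV f x :> D x" and Lip: "\<And>x y. norm (D x - D y) \<le> L * norm (x - y)" "L \<ge> 0"
    and h: "h = (\<lambda>x. ereal (H x))" and "\<alpha> > 0"
    and sub: "(1 / \<alpha>) *\<^sub>R (x - \<alpha> *\<^sub>R (D x + e) - p) \<in> subdifferential h p"
  shows "f p + H p \<le> f x + H x - (1 / \<alpha> - L) * (norm (p - x))\<^sup>2 + norm e * norm (p - x)"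
proof -
  define y where "y = (1 / \<alpha>) *\<^sub>R (x - p) - D x - e"
  have "y = (1 / \<alpha>) *\<^sub>R (x - \<alpha> *\<^sub>R (D x + e) - p)"
    using \<open>\<alpha> > 0\<close> by (simp add: y_def scaleR_diff_right scaleR_add_right)
  then have "H p + y \<bullet> (x - p) \<le> H x" using sub by (auto simp: subdifferential_def h)
  moreover have "y \<bullet> (x - p) = 1 / \<alpha> * (norm (p - x))\<^sup>2 - D x \<bullet> (x - p) - e \<bullet> (x - p)"
    by (simp add: y_def inner_diff_left power2_norm_eq_inner[symmetric] norm_minus_commute)
  moreover have "e \<bullet> (x - p) \<le> norm e * norm (p - x)"
    using norm_cauchy_schwarz[of e "x - p"] by (simp add: norm_minus_commute)
  moreover have "f p \<le> f x + D x \<bullet> (p - x) + L * (norm (p - x))\<^sup>2"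
    by (rule Lipschitz_gradient_upper_bound[OF grad Lip])
  moreover have "D x \<bullet> (p - x) = - (D x \<bullet> (x - p))" by (simp add: inner_diff_right)
  ultimately show ?thesis by (simp add: left_diff_distrib)
qed

text \<open>One round goes from \<open>X n\<close> by an inexact gradient step to
  \<open>W n\<close>, then to \<open>Z n\<close>, and lands within \<open>d n\<close> of it at
  \<open>X (Suc n)\<close>. Both errors perturb the descent of \<open>f + H\<close> summably, so the
  steps \<open>Z n - X n\<close> vanish, and with them the residual.\<close>

lemma inexact_prox_gradient_stationarity:
  fixes f H :: "'a::euclidean_space \<Rightarrow> real" and X Z W e :: "nat \<Rightarrow> 'a"
  assumes grad: "\<And>x. GDERIV f x :> D x" and Lip: "\<And>x y. norm (D x - D y) \<le> L * norm (x - y)" "L \<ge> 0"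
    and f_Lip: "\<And>x y. f y - f x \<le> Gf * norm (y - x)"
    and h: "h = (\<lambda>x. ereal (H x))" and H_Lip: "\<And>x y. \<bar>H x - H y\<bar> \<le> G * norm (x - y)"
    and alpha: "0 < \<alpha>" "L < 1 / \<alpha>"
    and sub: "\<And>n. (1 / \<alpha>) *\<^sub>R (W n - Z n) \<in> subdifferential h (Z n)"
    and WZ: "\<And>n. norm (W n - Z n) \<le> \<alpha> * G"
    and W: "\<And>n. W n = X n - \<alpha> *\<^sub>R (D (X n) + e n)"
    and De: "\<And>n. norm (D (X n) + e n) \<le> Gf"
    and X: "\<And>n. norm (X (Suc n) - Z n) \<le> d n"
    and e: "\<And>n. norm (e n) \<le> a n"
    and sum: "summable d" "summable a"
    and lower: "\<And>x. l \<le> f x + H x"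
  shows "(\<lambda>n. D (X (Suc n)) + (1 / \<alpha>) *\<^sub>R (W n - Z n)) \<longlonglongrightarrow> 0"
proof -
  \<comment> \<open>A uniform bound on the step length: the gradient part moves at most
    \<open>\<alpha> * Gf\<close>, the proximal part at most \<open>\<alpha> * G\<close>.\<close>
  define R where "R = \<alpha> * Gf + \<alpha> * G"
  have Gf0: "Gf \<ge> 0" using De norm_ge_zero order_trans by blast
  have "0 \<le> \<alpha> * G" using WZ norm_ge_zero order_trans by blast
  then have G0: "G \<ge> 0" using alpha by (simp add: zero_le_mult_iff)
  have d0: "0 \<le> d n" and a0: "0 \<le> a n" for n using X e norm_ge_zero order_trans by blast+
  have R: "norm (Z n - X n) \<le> R" for n
  proof -
    have "norm (W n - X n) \<le> \<alpha> * Gf"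
      unfolding W using De[of n] alpha(1) by simp
    then show ?thesis
      using norm_triangle_ineq4[of "W n - X n" "W n - Z n"] WZ[of n] by (simp add: R_def)
  qed
  define F where "F n = f (X n) + H (X n)" for n
  \<comment> \<open>The first term pays for the gradient error, the second for replacing
    \<open>Z n\<close> by \<open>X (Suc n)\<close> in the Lipschitz function
    \<open>f + H\<close>.\<close>
  define s where "s n = a n * R + (Gf + G) * d n" for n
  have R0: "R \<ge> 0" using R norm_ge_zero order_trans by blast
  have "(\<lambda>n. (1 / \<alpha> - L) * (norm (Z n - X n))\<^sup>2) \<longlonglongrightarrow> 0"
  proof (rule descent_imp_null_sequence)
    fix n
    have "f (Z n) + H (Z n) \<le> F n - (1 / \<alpha> - L) * (norm (Z n - X n))\<^sup>2 + norm (e n) * norm (Z n - X n)"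
      unfolding F_def using sub[of n, unfolded W] by (intro prox_gradient_descent[OF grad Lip h alpha(1)])
    moreover have "norm (e n) * norm (Z n - X n) \<le> a n * R"
      using e[of n] R[of n] a0[of n] by (intro mult_mono) auto
    moreover have "F (Suc n) \<le> f (Z n) + H (Z n) + (Gf + G) * norm (X (Suc n) - Z n)"
      using f_Lip[of "X (Suc n)" "Z n"] H_Lip[of "X (Suc n)" "Z n"] by (simp add: F_def algebra_simps)
    moreover have "(Gf + G) * norm (X (Suc n) - Z n) \<le> (Gf + G) * d n"
      using X[of n] Gf0 G0 by (intro mult_left_mono) auto
    ultimately show "F (Suc n) \<le> F n - (1 / \<alpha> - L) * (norm (Z n - X n))\<^sup>2 + s n"
      by (simp add: s_def)
  next
    show "summable s" unfolding s_def
      by (intro summable_add summable_mult summable_mult2 sum)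
  qed (use alpha a0 d0 R0 Gf0 G0 lower in \<open>auto simp: s_def F_def\<close>)
  then have "(\<lambda>n. 1 / (1 / \<alpha> - L) * ((1 / \<alpha> - L) * (norm (Z n - X n))\<^sup>2)) \<longlonglongrightarrow> 1 / (1 / \<alpha> - L) * 0"
    by (intro tendsto_mult_left)
  then have "(\<lambda>n. (norm (Z n - X n))\<^sup>2) \<longlonglongrightarrow> 0" using alpha by simp
  then have ZX: "(\<lambda>n. norm (Z n - X n)) \<longlonglongrightarrow> 0"
    using tendsto_real_sqrt by fastforce
  define b where "b n = L * (d n + norm (Z n - X n)) + a n + 1 / \<alpha> * norm (Z n - X n)" for n
  have "norm (D (X (Suc n)) + (1 / \<alpha>) *\<^sub>R (W n - Z n)) \<le> b n" for n
  proof -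
    \<comment> \<open>Inserting the formula for \<open>W n\<close> leaves a gradient difference, the
      gradient error and the scaled step, all of which vanish.\<close>
    have "D (X (Suc n)) + (1 / \<alpha>) *\<^sub>R (W n - Z n)
        = (D (X (Suc n)) - D (X n)) - e n - (1 / \<alpha>) *\<^sub>R (Z n - X n)"
      unfolding W using alpha(1) by (simp add: scaleR_diff_right scaleR_add_right)
    also have "norm \<dots> \<le> norm (D (X (Suc n)) - D (X n)) + norm (e n) + norm ((1 / \<alpha>) *\<^sub>R (Z n - X n))"
      by (meson norm_triangle_ineq4 add_right_mono order_trans)
    finally have 1: "norm (D (X (Suc n)) + (1 / \<alpha>) *\<^sub>R (W n - Z n))
      \<le> norm (D (X (Suc n)) - D (X n)) + norm (e n) + 1 / \<alpha> * norm (Z n - X n)" using alpha(1) by simp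
    have "norm (X (Suc n) - X n) \<le> d n + norm (Z n - X n)"
      using norm_triangle_ineq[of "X (Suc n) - Z n" "Z n - X n"] X[of n] by simp
    then have "L * norm (X (Suc n) - X n) \<le> L * (d n + norm (Z n - X n))"
      using Lip(2) by (intro mult_left_mono)
    then show ?thesis using 1 Lip(1)[of "X (Suc n)" "X n"] e[of n] by (simp add: b_def)
  qed
  moreover have "b \<longlonglongrightarrow> L * (0 + 0) + 0 + 1 / \<alpha> * 0"
    unfolding b_def using sum by (intro tendsto_intros ZX summable_LIMSEQ_zero)
  ultimately show ?thesis
    using Lim_null_comparison[of "\<lambda>n. D (X (Suc n)) + (1 / \<alpha>) *\<^sub>R (W n - Z n)" b sequentially] by simp
qed

section \<open>Mixing of doubly stochastic products\<close>

lemma doubly_stochastic_matrix_mult: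
  assumes "doubly_stochastic M" "doubly_stochastic P"
  shows "doubly_stochastic (M ** P)"
proof -
  have "(\<Sum>j\<in>UNIV. \<Sum>l\<in>UNIV. M $ i $ l * P $ l $ j) = 1" for i
    using assms unfolding doubly_stochastic_def
    by (subst sum.swap) (simp flip: sum_distrib_left)
  moreover have "(\<Sum>i\<in>UNIV. \<Sum>l\<in>UNIV. M $ i $ l * P $ l $ j) = 1" for j
    using assms unfolding doubly_stochastic_def
    by (subst sum.swap) (simp flip: sum_distrib_right)
  ultimately show ?thesis
    using assms unfolding doubly_stochastic_def
    by (simp add: matrix_matrix_mult_def sum_nonneg)
qed

lemma doubly_stochastic_transition:
  assumes "\<forall>t\<ge>1. doubly_stochastic (A t)" "1 \<le> s"
  shows "doubly_stochastic (transition A t s)"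
  using assms by (induction t) (auto intro: doubly_stochastic_matrix_mult)

text \<open>Cuts the product between the times \<open>u\<close> and \<open>Suc u\<close>. For
  \<open>t = Suc u\<close> the left factor is the single matrix \<open>A t\<close>.\<close>

lemma transition_split:
  assumes "s \<le> u" "u < t"
  shows "transition A t s = transition A t (Suc u) ** transition A u s"
  using assms by (induction t) (auto simp: less_Suc_eq matrix_mul_assoc)

text \<open>Information crosses the edge once and otherwise stays put through the self-weights, so
  each of the \<open>Suc (t - s)\<close> factors contributes at least \<open>\<eta>\<close>.\<close>

lemma transition_lower_bound:
  fixes A :: "nat \<Rightarrow> real^'m::finite^'m"
  assumes weights: "network_weights \<eta> E A" and st: "\<forall>t\<ge>1. doubly_stochastic (A t)"
    and eta: "0 < \<eta>" and "1 \<le> s" "s \<le> t"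
    and "i = j \<or> (\<exists>r\<in>{s..t}. {i, j} \<in> E r)"
  shows "\<eta> ^ Suc (t - s) \<le> transition A t s $ i $ j"
  using assms(5,6)
proof (induction t arbitrary: i j rule: dec_induct)
  case base
  have "transition A s s = A s" by (cases s) auto
  then show ?case using weights base \<open>1 \<le> s\<close> by (cases "i = j") (auto simp: network_weights_def)
next
  case (step t)
  define P where "P = transition A t s"
  have entry: "A (Suc t) $ i $ l * P $ l $ j \<le> transition A (Suc t) s $ i $ j" for l
  proof -
    have "doubly_stochastic P" "doubly_stochastic (A (Suc t))"
      using doubly_stochastic_transition[OF st \<open>1 \<le> s\<close>] st by (simp_all add: P_def)
    then have "A (Suc t) $ i $ l * P $ l $ j \<le> (\<Sum>l\<in>UNIV. A (Suc t) $ i $ l * P $ l $ j)"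
      by (intro member_le_sum) (auto simp: doubly_stochastic_def)
    then show ?thesis using step.hyps by (simp add: P_def matrix_matrix_mult_def)
  qed
  \<comment> \<open>The intermediate agent is \<open>i\<close> if the older product already links
    \<open>i\<close> and \<open>j\<close>; otherwise the edge is active at time
    \<open>Suc t\<close>, and it is \<open>j\<close>, with the diagonal bound for
    \<open>P\<close>.\<close>
  have "\<exists>l. \<eta> \<le> A (Suc t) $ i $ l \<and> \<eta> ^ Suc (t - s) \<le> P $ l $ j"
  proof (cases "i = j \<or> (\<exists>r\<in>{s..t}. {i, j} \<in> E r)")
    case True
    then show ?thesis using step.IH weights by (auto simp: network_weights_def P_def intro!: exI[of _ i])
  next
    case False
    then have "i \<noteq> j" "{i, j} \<in> E (Suc t)" using step.prems by (auto simp: le_Suc_eq)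
    then show ?thesis using step.IH[of j j] weights by (auto simp: network_weights_def P_def intro!: exI[of _ j])
  qed
  then obtain l where "\<eta> \<le> A (Suc t) $ i $ l" "\<eta> ^ Suc (t - s) \<le> P $ l $ j" by blast
  then have "\<eta> * \<eta> ^ Suc (t - s) \<le> A (Suc t) $ i $ l * P $ l $ j"
    using eta by (intro mult_mono) auto
  then show ?case using entry[of l] step.hyps by (simp add: Suc_diff_le)
qed

text \<open>The columns of \<open>P\<close> sum to \<open>1\<close>, so in the deviation of \<open>M ** P\<close> from the uniform matrix the
  entries of \<open>M\<close> may all be reduced by \<open>\<delta>\<close>.\<close>

lemma doubly_stochastic_contraction:
  fixes M P :: "real^'m::finite^'m"
  assumes M: "doubly_stochastic M" and P: "doubly_stochastic P"
    and \<delta>: "0 \<le> \<delta>" "\<And>i j. \<delta> \<le> M $ i $ j"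
    and b: "\<And>i j. \<bar>P $ i $ j - 1 / real CARD('m)\<bar> \<le> b"
  shows "\<bar>(M ** P) $ i $ j - 1 / real CARD('m)\<bar> \<le> (1 - \<delta>) * b"
proof -
  define u where "u = 1 / real CARD('m)"
  have row: "(\<Sum>l\<in>UNIV. M $ i $ l) = 1" and col: "(\<Sum>l\<in>UNIV. P $ l $ j) = 1"
    using M P by (auto simp: doubly_stochastic_def)
  have "(M ** P) $ i $ j - u = (\<Sum>l\<in>UNIV. M $ i $ l * (P $ l $ j - u))"
    using row by (simp add: matrix_matrix_mult_def right_diff_distrib sum_subtractf flip: sum_distrib_right)
  also have "\<dots> = (\<Sum>l\<in>UNIV. (M $ i $ l - \<delta>) * (P $ l $ j - u))"
  proof -
    have "(\<Sum>l\<in>UNIV. P $ l $ j - u) = 0" using col by (simp add: sum_subtractf u_def)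
    then have "(\<Sum>l\<in>UNIV. \<delta> * (P $ l $ j - u)) = 0" by (simp flip: sum_distrib_left)
    then show ?thesis by (simp add: left_diff_distrib sum_subtractf)
  qed
  also have "\<bar>\<dots>\<bar> \<le> (\<Sum>l\<in>UNIV. \<bar>(M $ i $ l - \<delta>) * (P $ l $ j - u)\<bar>)" by (rule sum_abs)
  also have "\<dots> \<le> (\<Sum>l\<in>UNIV. (M $ i $ l - \<delta>) * b)"
    using \<delta> b by (intro sum_mono) (auto simp: abs_mult u_def intro!: mult_left_mono)
  also have "\<dots> = (1 - real CARD('m) * \<delta>) * b"
    using row by (simp add: sum_subtractf flip: sum_distrib_right)
  \<comment> \<open>The factor \<open>1 - CARD('m) * \<delta>\<close> is weakened, as there is at
    least one agent.\<close>
  also have "\<dots> \<le> (1 - \<delta>) * b"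
  proof (rule mult_right_mono)
    have "1 * \<delta> \<le> real CARD('m) * \<delta>" using \<delta>(1) by (intro mult_right_mono) (auto simp: Suc_le_eq)
    then show "1 - real CARD('m) * \<delta> \<le> 1 - \<delta>" by simp
    show "0 \<le> b" using b abs_ge_zero order_trans by blast
  qed
  finally show ?thesis by (simp add: u_def)
qed

lemma doubly_stochastic_deviation_le_1:
  fixes P :: "real^'m::finite^'m"
  assumes "doubly_stochastic P"
  shows "\<bar>P $ i $ j - 1 / real CARD('m)\<bar> \<le> 1"
proof -
  have "P $ i $ j \<le> (\<Sum>l\<in>UNIV. P $ i $ l)"
    using assms by (intro member_le_sum) (auto simp: doubly_stochastic_def)
  moreover have "1 / real CARD('m) \<le> 1" "0 < 1 / real CARD('m)" by (simp_all add: Suc_le_eq)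
  moreover have "0 \<le> P $ i $ j" "(\<Sum>l\<in>UNIV. P $ i $ l) = 1"
    using assms by (auto simp: doubly_stochastic_def)
  ultimately show ?thesis by linarith
qed

text \<open>Each block of \<open>B\<close> newest factors, split off on the left, contracts the
  deviation by \<open>1 - \<delta>\<close>; the leftover product has deviation at most 1.\<close>

lemma transition_deviation_block:
  fixes A :: "nat \<Rightarrow> real^'m::finite^'m"
  assumes st: "\<forall>t\<ge>1. doubly_stochastic (A t)" and "1 \<le> s" "1 \<le> B" "0 \<le> \<delta>"
    and block: "\<And>u i j. 1 \<le> u \<Longrightarrow> \<delta> \<le> transition A (u + B - 1) u $ i $ j"
  shows "\<bar>transition A (s + (k * B + r)) s $ i $ j - 1 / real CARD('m)\<bar> \<le> (1 - \<delta>) ^ k"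
proof (induction k arbitrary: i j)
  case 0
  then show ?case using doubly_stochastic_deviation_le_1[OF doubly_stochastic_transition[OF st \<open>1 \<le> s\<close>]]
    by simp
next
  case (Suc k)
  define u where "u = s + (k * B + r)"
  have eq: "s + (Suc k * B + r) = Suc u + B - 1" by (simp add: u_def)
  have "transition A (Suc u + B - 1) s = transition A (Suc u + B - 1) (Suc u) ** transition A u s"
    using \<open>1 \<le> B\<close> by (intro transition_split) (auto simp: u_def)
  moreover have "\<bar>(transition A (Suc u + B - 1) (Suc u) ** transition A u s) $ i $ j - 1 / real CARD('m)\<bar>
      \<le> (1 - \<delta>) * (1 - \<delta>) ^ k"
    using st \<open>1 \<le> s\<close> \<open>0 \<le> \<delta>\<close> block[of "Suc u"] Suc.IH
    by (intro doubly_stochastic_contraction doubly_stochastic_transition) (auto simp: u_def)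
  ultimately show ?case by (simp only: eq power_Suc)
qed

text \<open>Within \<open>B\<close> consecutive slots every pair communicates directly, so all
  entries of a product of \<open>B\<close> factors are at least \<open>\<eta> ^ B\<close>.\<close>

lemma geometric_mixing:
  fixes A :: "nat \<Rightarrow> real^'m::finite^'m"
  assumes weights: "network_weights \<eta> E A" and st: "\<forall>t\<ge>1. doubly_stochastic (A t)"
    and eta: "0 < \<eta>" "\<eta> < 1" and conn: "uniformly_connected E"
  shows "\<exists>C \<rho>. 0 \<le> C \<and> 0 < \<rho> \<and> \<rho> < 1 \<and>
    (\<forall>s\<ge>1. \<forall>n i j. \<bar>transition A (s + n) s $ i $ j - 1 / real CARD('m)\<bar> \<le> C * \<rho> ^ n)"
proof -
  obtain B where B: "B \<ge> 1" "\<forall>i j. i \<noteq> j \<longrightarrow> (\<forall>t\<ge>1. \<exists>r\<in>{t..t + B - 1}. {i, j} \<in> E r)"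
    using conn[unfolded uniformly_connected_def, THEN conjunct2] by (elim exE conjE)
  define \<delta> where "\<delta> = \<eta> ^ B"
  have \<delta>: "0 < \<delta>" "\<delta> < 1"
    using eta B(1) by (auto simp: \<delta>_def intro: power_less_one_iff[THEN iffD2])
  have block: "\<delta> \<le> transition A (u + B - 1) u $ i $ j" if "1 \<le> u" for u i j
  proof -
    have "\<eta> ^ Suc (u + B - 1 - u) \<le> transition A (u + B - 1) u $ i $ j"
      using B that by (intro transition_lower_bound[OF weights st eta(1)]) auto
    then show ?thesis using B(1) by (simp add: \<delta>_def)
  qed
  \<comment> \<open>Spreads the contraction of one block evenly over its \<open>B\<close> slots; the
    constant \<open>inverse (\<rho> ^ B)\<close> absorbs an incomplete block.\<close>
  define \<rho> where "\<rho> = root B (1 - \<delta>)"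
  have \<rho>: "0 < \<rho>" "\<rho> < 1" "\<rho> ^ B = 1 - \<delta>"
    using \<delta> B(1) by (auto simp: \<rho>_def)
  have "\<bar>transition A (s + n) s $ i $ j - 1 / real CARD('m)\<bar> \<le> inverse (\<rho> ^ B) * \<rho> ^ n" if "1 \<le> s" for s n i j
  proof -
    have "\<bar>transition A (s + (n div B * B + n mod B)) s $ i $ j - 1 / real CARD('m)\<bar> \<le> (\<rho> ^ B) ^ (n div B)"
      unfolding \<rho>(3) using \<delta> by (intro transition_deviation_block[OF st that B(1) _ block]) auto
    also have "\<dots> = \<rho> ^ (B * (n div B))" by (simp add: power_mult)
    also have "\<dots> = inverse (\<rho> ^ B) * \<rho> ^ (B * (n div B) + B)"
      using \<rho>(1) by (simp add: power_add)
    also have "\<dots> \<le> inverse (\<rho> ^ B) * \<rho> ^ n"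
    proof (intro mult_left_mono power_decreasing)
      have "n mod B \<le> B" using B(1) by (simp add: less_imp_le)
      then show "n \<le> B * (n div B) + B"
        using mult_div_mod_eq[of B n] by linarith
    qed (use \<rho> \<delta> in auto)
    finally show ?thesis by simp
  qed
  then show ?thesis using \<rho> \<delta> by (intro exI[of _ "inverse (\<rho> ^ B)"] exI[of _ \<rho>]) auto
qed

text \<open>A combination of the geometric series and its termwise derivative.\<close>

lemma summable_linear_times_geometric:
  fixes a b \<rho> :: real
  assumes "0 \<le> \<rho>" "\<rho> < 1"
  shows "summable (\<lambda>n. (a + real n * b) * \<rho> ^ n)"
proof -
  have 1: "summable (\<lambda>n. real (Suc n) * \<rho> ^ n)"
    using geometric_deriv_sums[of \<rho>] assms by (auto simp: sums_iff)
  have 2: "summable (\<lambda>n. \<rho> ^ n)" using assms by (simp add: summable_geometric)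
  have "(\<lambda>n. (a + real n * b) * \<rho> ^ n) = (\<lambda>n. b * (real (Suc n) * \<rho> ^ n) + (a - b) * \<rho> ^ n)"
    by (auto simp: algebra_simps)
  then show ?thesis using summable_add[OF summable_mult[OF 1] summable_mult[OF 2]] by simp
qed

section \<open>Consensus and convergence\<close>

lemma agent_mean_diff: "agent_mean (\<lambda>i. y i - y' i) = agent_mean y - agent_mean y'"
  by (simp add: agent_mean_def sum_subtractf scaleR_diff_right)

lemma agent_mean_const [simp]: "agent_mean (\<lambda>_::'m::finite. w) = w"
  by (simp add: agent_mean_def sum_constant_scaleR)

lemma agent_mean_scaleR: "agent_mean (\<lambda>i. c *\<^sub>R y i) = c *\<^sub>R agent_mean y"
  by (simp add: agent_mean_def flip: scaleR_sum_right)

lemma norm_agent_mean_le: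
  fixes y :: "'m::finite \<Rightarrow> 'a::real_normed_vector"
  assumes "\<And>i. norm (y i) \<le> c"
  shows "norm (agent_mean y) \<le> c"
proof -
  have "norm (\<Sum>i\<in>UNIV. y i) \<le> real CARD('m) * c"
    using sum_norm_bound[of UNIV y c] assms by simp
  then show ?thesis by (simp add: agent_mean_def divide_simps mult.commute)
qed

lemma norm_agent_mean_diff_le:
  fixes y :: "'m::finite \<Rightarrow> 'a::real_normed_vector"
  assumes "\<And>i. norm (y i - w) \<le> c"
  shows "norm (agent_mean y - w) \<le> c"
  using norm_agent_mean_le[of "\<lambda>i. y i - w" c] assms by (simp add: agent_mean_diff)

lemma GDERIV_agent_mean:
  fixes g :: "'m::finite \<Rightarrow> 'a::euclidean_space \<Rightarrow> real"
  assumes "\<And>i. GDERIV (g i) x :> D i"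
  shows "GDERIV (\<lambda>y. agent_mean (\<lambda>i. g i y)) x :> agent_mean D"
  unfolding gderiv_def agent_mean_def inner_scaleR_right inner_sum_right
  using assms by (auto simp: gderiv_def intro!: derivative_eq_intros)

lemma norm_stochastic_combination_le:
  fixes q :: "'m::finite \<Rightarrow> 'a::real_normed_vector"
  assumes "doubly_stochastic P" "\<And>j. norm (q j) \<le> c"
  shows "norm (\<Sum>j\<in>UNIV. P $ i $ j *\<^sub>R q j) \<le> c"
proof -
  have "norm (\<Sum>j\<in>UNIV. P $ i $ j *\<^sub>R q j) \<le> (\<Sum>j\<in>UNIV. P $ i $ j * c)"
    using assms by (intro sum_norm_le) (auto simp: doubly_stochastic_def intro!: mult_left_mono)
  also have "\<dots> = c" using assms(1) by (simp add: doubly_stochastic_def flip: sum_distrib_right)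
  finally show ?thesis .
qed

text \<open>Unit column sums: mixing preserves the network average, which turns the averaged
  iteration into a gradient step.\<close>

lemma agent_mean_doubly_stochastic:
  assumes "doubly_stochastic P"
  shows "agent_mean (\<lambda>i. \<Sum>j\<in>UNIV. P $ i $ j *\<^sub>R q j) = agent_mean q"
proof -
  have "(\<Sum>i\<in>UNIV. \<Sum>j\<in>UNIV. P $ i $ j *\<^sub>R q j) = (\<Sum>j\<in>UNIV. q j)"
    using assms by (subst sum.swap) (simp add: doubly_stochastic_def flip: scaleR_sum_left)
  then show ?thesis by (simp add: agent_mean_def)
qed

lemma consensus_error_le:
  fixes q :: "'m::finite \<Rightarrow> 'a::real_normed_vector" and P :: "real^'m^'m"
  assumes "\<And>i j. \<bar>P $ i $ j - 1 / real CARD('m)\<bar> \<le> b" "\<And>j. norm (q j) \<le> c"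
  shows "norm ((\<Sum>j\<in>UNIV. P $ i $ j *\<^sub>R q j) - agent_mean q) \<le> real CARD('m) * (b * c)"
proof -
  have "(\<Sum>j\<in>UNIV. P $ i $ j *\<^sub>R q j) - agent_mean q = (\<Sum>j\<in>UNIV. (P $ i $ j - 1 / real CARD('m)) *\<^sub>R q j)"
    by (simp add: agent_mean_def scaleR_sum_right scaleR_diff_left sum_subtractf)
  also have "norm \<dots> \<le> (\<Sum>j\<in>(UNIV::'m set). b * c)"
    using assms by (intro sum_norm_le) (auto intro!: mult_mono order_trans[OF abs_ge_zero assms(1)])
  finally show ?thesis by simp
qed

text \<open>The network hypotheses concern times from 1 on. The algorithm first mixes at index 2, so
  its products start late enough.\<close>

lemma comm_steps_ge_1: "2 \<le> k \<Longrightarrow> 1 \<le> comm_steps k"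
  unfolding comm_steps_def using member_le_sum[of 1 "{1..<k}" "\<lambda>l. l"] by simp

text \<open>Mixing does not increase the largest norm, and the gradient and proximal parts add
  bounded amounts, so the iterates grow at most linearly. The mixing error at iteration
  \<open>k\<close> is of order \<open>\<rho> ^ k\<close>, because \<open>k\<close> communication
  steps are performed; the product is summable.\<close>

lemma dist_prox_gradient_consensus:
  fixes g :: "'m::finite \<Rightarrow> 'a::euclidean_space \<Rightarrow> real" and x q v :: "'m \<Rightarrow> nat \<Rightarrow> 'a"
  assumes weights: "network_weights \<eta> E A" and st: "\<forall>t\<ge>1. doubly_stochastic (A t)"
    and eta: "0 < \<eta>" "\<eta> < 1" and conn: "uniformly_connected E"
    and alg: "dist_prox_gradient \<alpha> A g h x q v" and "0 \<le> \<alpha>"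
    and g: "\<And>i y. norm (grad (g i) y) \<le> Gg"
    and prox: "\<And>w. norm (prox \<alpha> h w - w) \<le> \<alpha> * G"
  obtains d where "summable d" "\<And>n i. norm (v i (Suc (Suc n)) - agent_mean (\<lambda>i. q i (Suc (Suc n)))) \<le> d n"
proof -
  obtain C \<rho> where C: "0 \<le> C" "0 < \<rho>" "\<rho> < 1" and mix:
    "\<And>s n i j. 1 \<le> s \<Longrightarrow> \<bar>transition A (s + n) s $ i $ j - 1 / real CARD('m)\<bar> \<le> C * \<rho> ^ n"
    using geometric_mixing[OF weights st eta conn] by auto
  define P where "P n = mixing A (Suc (Suc n))" for n
  have P: "doubly_stochastic (P n)" for n
    unfolding P_def mixing_def by (intro doubly_stochastic_transition st comm_steps_ge_1) simp
  have q: "q i (Suc (Suc n)) = x i (Suc n) - \<alpha> *\<^sub>R grad (g i) (x i (Suc n))"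
    and v: "v i (Suc (Suc n)) = (\<Sum>j\<in>UNIV. P n $ i $ j *\<^sub>R q j (Suc (Suc n)))"
    and x: "x i (Suc (Suc n)) = prox \<alpha> h (v i (Suc (Suc n)))" for i n
    using alg unfolding dist_prox_gradient_def P_def by (metis Suc_eq_plus1 le_add2)+
  define M where "M = (\<Sum>i\<in>UNIV. norm (x i 1))"
  define D where "D = \<alpha> * Gg + \<alpha> * G"
  have q_le: "norm (q i (Suc (Suc n))) \<le> c + \<alpha> * Gg" if "norm (x i (Suc n)) \<le> c" for i n c
  proof -
    have "norm (\<alpha> *\<^sub>R grad (g i) (x i (Suc n))) \<le> \<alpha> * Gg"
      using g \<open>0 \<le> \<alpha>\<close> by (simp add: mult_left_mono)
    then show ?thesis
      unfolding q using that norm_triangle_ineq4 by (meson add_mono order_trans)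
  qed
  have growth: "norm (x i (Suc n)) \<le> M + real n * D" for i n
  proof (induction n arbitrary: i)
    case 0
    show ?case unfolding M_def using member_le_sum[of i UNIV "\<lambda>i. norm (x i 1)"] by simp
  next
    case (Suc n)
    have "norm (v i (Suc (Suc n))) \<le> M + real n * D + \<alpha> * Gg"
      unfolding v by (intro norm_stochastic_combination_le P q_le Suc)
    moreover have "norm (x i (Suc (Suc n)) - v i (Suc (Suc n))) \<le> \<alpha> * G"
      unfolding x by (rule prox)
    ultimately have "norm (x i (Suc (Suc n))) \<le> M + real n * D + \<alpha> * Gg + \<alpha> * G"
      using norm_triangle_sub[of "x i (Suc (Suc n))" "v i (Suc (Suc n))"] by linarith
    then show ?case by (simp add: D_def algebra_simps)
  qed
  \<comment> \<open>The exponent is the iteration index \<open>Suc (Suc n)\<close>; the last factor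
    bounds the norms of the points being mixed.\<close>
  define d where "d n = real CARD('m) * ((C * \<rho> ^ Suc (Suc n)) * (M + real n * D + \<alpha> * Gg))" for n
  show thesis
  proof (rule that)
    have "d = (\<lambda>n. real CARD('m) * C * \<rho>\<^sup>2 * ((M + \<alpha> * Gg + real n * D) * \<rho> ^ n))"
      by (auto simp: d_def power2_eq_square algebra_simps)
    then show "summable d"
      using C by (simp only:) (intro summable_mult summable_linear_times_geometric; simp)
    show "norm (v i (Suc (Suc n)) - agent_mean (\<lambda>i. q i (Suc (Suc n)))) \<le> d n" for n i
      unfolding v d_def
      by (intro consensus_error_le q_le growth) (unfold P_def mixing_def, intro mix comm_steps_ge_1, simp)
  qed
qed

theorem mainTheorem2:
  fixes g :: "'m::finite \<Rightarrow> real^'n \<Rightarrow> real"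
    and h :: "real^'n \<Rightarrow> ereal"
    and E :: "nat \<Rightarrow> 'm set set"
    and A :: "nat \<Rightarrow> real^'m^'m"
    and x q v :: "'m \<Rightarrow> nat \<Rightarrow> real^'n"
    and xbar vbar :: "nat \<Rightarrow> real^'n"
    and \<epsilon> :: "nat \<Rightarrow> real"
    and L Gg Gh \<eta> \<alpha> :: real
  assumes h_closed: "closed_fun h"
    and h_proper: "proper_fun h"
    and L_pos: "L > 0"
    and g_C1: "\<forall>i. continuously_differentiable (g i)"
    and g_Lipschitz: "\<forall>i y z. norm (grad (g i) y - grad (g i) z) \<le> L * norm (y - z)"
    and h_convex: "convex_fun h"
    and g_bound: "\<forall>i y. norm (grad (g i) y) < Gg"
    and h_bound: "\<forall>y. \<forall>z\<in>subdifferential h y. norm z < Gh"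
    and optimum: "\<exists>xstar. \<forall>y. objective g h xstar \<le> objective g h y"
    and graph: "\<forall>t\<ge>1. \<forall>e\<in>E t. card e = 2"
    and symmetric: "\<forall>t\<ge>1. transpose (A t) = A t"
    and stochastic: "\<forall>t\<ge>1. doubly_stochastic (A t)"
    and eta: "0 < \<eta>" "\<eta> < 1"
    and weights: "network_weights \<eta> E A"
    and connected: "uniformly_connected E"
    and step_size: "0 < \<alpha>" "\<alpha> < 1 / L"
    and algorithm: "dist_prox_gradient \<alpha> A g h x q v"
    and xbar: "\<forall>k\<ge>1. xbar k = agent_mean (\<lambda>i. x i k)"
    and vbar: "\<forall>k\<ge>2. vbar k = agent_mean (\<lambda>i. v i k)"
    and error: "\<forall>k\<ge>2. \<epsilon> k = prox_error \<alpha> Gh h (xbar k) (vbar k)"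
  shows "(\<lambda>k. min_norm ((+) (grad (\<lambda>y. agent_mean (\<lambda>i. g i y)) (xbar k)) `
                          eps_subdifferential (\<epsilon> k) h (xbar k))) \<longlonglongrightarrow> 0"
proof -
  define f where "f y = agent_mean (\<lambda>i. g i y)" for y
  define D where "D y = agent_mean (\<lambda>i. grad (g i) y)" for y
  have f_grad: "GDERIV f y :> D y" for y
    unfolding f_def D_def using g_C1
    by (intro GDERIV_agent_mean GDERIV_grad) (simp add: continuously_differentiable_def)
  have grad_f: "grad (\<lambda>y. agent_mean (\<lambda>i. g i y)) y = D y" for y
    using grad_eqI[OF f_grad] unfolding f_def .
  have D_Lip: "norm (D y - D z) \<le> L * norm (y - z)" for y z
    unfolding D_def agent_mean_diff[symmetric] using g_Lipschitz by (intro norm_agent_mean_le) blast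
  have g_le: "norm (grad (g i) y) \<le> Gg" for i y using g_bound by (simp add: less_imp_le)
  have f_Lip: "f y - f z \<le> Gg * norm (y - z)" for y z
    by (rule bounded_gradient_imp_Lipschitz[OF f_grad]) (simp add: D_def norm_agent_mean_le g_le)
  obtain H where h: "h = (\<lambda>y. ereal (H y))" and H_Lip: "\<And>y z. \<bar>H y - H z\<bar> \<le> Gh * norm (y - z)"
    by (rule bounded_subgradients_imp_Lipschitz[OF h_closed h_convex h_proper, of Gh]) (use h_bound in auto)
  have sub: "(1 / \<alpha>) *\<^sub>R (w - prox \<alpha> h w) \<in> subdifferential h (prox \<alpha> h w)" for w
    by (rule prox_subgradient[OF h_closed h_convex h_proper step_size(1)])
  have prox_le: "norm (w - prox \<alpha> h w) \<le> \<alpha> * Gh" for w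
  proof -
    have "norm ((1 / \<alpha>) *\<^sub>R (w - prox \<alpha> h w)) < Gh" using h_bound sub by blast
    then show ?thesis unfolding norm_scaleR using step_size(1) by (simp add: field_simps)
  qed
  \<comment> \<open>The optimal value is the lower bound on \<open>f + H\<close> that the descent
    argument requires.\<close>
  obtain xstar where "objective g h xstar \<le> objective g h y" for y using optimum by blast
  moreover have "objective g h y = ereal (f y + H y)" for y
    by (simp add: objective_def h f_def agent_mean_def sum.distrib distrib_left)
  ultimately have lower: "f xstar + H xstar \<le> f y + H y" for y by simp

  obtain d where d: "summable d"
    and "\<And>n i. norm (v i (Suc (Suc n)) - agent_mean (\<lambda>i. q i (Suc (Suc n)))) \<le> d n"
    by (rule dist_prox_gradient_consensus[OF weights stochastic eta connected algorithm, of Gg Gh])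
      (use step_size prox_le g_le in \<open>auto simp: norm_minus_commute\<close>)
  moreover have q: "q i (Suc (Suc n)) = x i (Suc n) - \<alpha> *\<^sub>R grad (g i) (x i (Suc n))"
    and v: "v i (Suc (Suc n)) = (\<Sum>j\<in>UNIV. mixing A (Suc (Suc n)) $ i $ j *\<^sub>R q j (Suc (Suc n)))"
    and x: "x i (Suc (Suc n)) = prox \<alpha> h (v i (Suc (Suc n)))" for i n
    using algorithm unfolding dist_prox_gradient_def by (metis Suc_eq_plus1 le_add2)+
  moreover have "doubly_stochastic (mixing A (Suc (Suc n)))" for n
    unfolding mixing_def by (intro doubly_stochastic_transition stochastic comm_steps_ge_1) simp
  then have vbar_q: "vbar (Suc (Suc n)) = agent_mean (\<lambda>i. q i (Suc (Suc n)))" for n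
    using vbar by (simp add: v agent_mean_doubly_stochastic)
  ultimately have v_d: "norm (v i (Suc (Suc n)) - vbar (Suc (Suc n))) \<le> d n" for i n by simp

  define Z where "Z n = prox \<alpha> h (vbar (Suc (Suc n)))" for n
  \<comment> \<open>Nonexpansiveness transfers the consensus of the mixed points to the iterates,
    with \<open>Z n\<close> as common reference point.\<close>
  have x_Z: "norm (x i (Suc (Suc n)) - Z n) \<le> d n" for i n
    unfolding x Z_def using prox_nonexpansive[OF h step_size(1) sub] v_d order_trans by blast
  then have xbar_Z: "norm (xbar (Suc (Suc n)) - Z n) \<le> d n" for n
    using xbar by (simp add: norm_agent_mean_diff_le)
  have x_xbar: "norm (x i (Suc (Suc n)) - xbar (Suc (Suc n))) \<le> 2 * d n" for i n
    using norm_triangle_ineq4[of "x i (Suc (Suc n)) - Z n" "xbar (Suc (Suc n)) - Z n"]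
      x_Z[of i n] xbar_Z[of n] by simp

  \<comment> \<open>The sequence starts at iteration 2, as the initial points may disagree
    arbitrarily. Since \<open>W n\<close> belongs to iteration \<open>n + 3\<close>, its proximal
    point is \<open>Z (Suc n)\<close>.\<close>
  define X where "X n = xbar (Suc (Suc n))" for n
  define W where "W n = vbar (Suc (Suc (Suc n)))" for n
  \<comment> \<open>The error from evaluating the gradients at the agents' own points instead of at
    their mean.\<close>
  define e where "e n = agent_mean (\<lambda>i. grad (g i) (x i (Suc (Suc n)))) - D (X n)" for n
  have W_eq: "W n = X n - \<alpha> *\<^sub>R (D (X n) + e n)" for n
    using xbar by (simp add: W_def X_def e_def vbar_q q agent_mean_diff agent_mean_scaleR)
  have e_le: "norm (e n) \<le> L * (2 * d n)" for n
    unfolding e_def D_def agent_mean_diff[symmetric] X_def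
    using g_Lipschitz x_xbar[of _ n] L_pos
    by (intro norm_agent_mean_le) (meson mult_left_mono less_imp_le order_trans)
  have "(\<lambda>n. D (X (Suc n)) + (1 / \<alpha>) *\<^sub>R (W n - Z (Suc n))) \<longlonglongrightarrow> 0"
  proof (rule inexact_prox_gradient_stationarity[where f = f and H = H and h = h and L = L
        and a = "\<lambda>n. L * (2 * d n)" and d = "\<lambda>n. d (Suc n)" and \<alpha> = \<alpha>, OF f_grad D_Lip])
    show "L < 1 / \<alpha>" using step_size L_pos by (simp add: field_simps)
    show "norm (D (X n) + e n) \<le> Gg" for n
      by (simp add: e_def norm_agent_mean_le g_le)
    show "summable (\<lambda>n. d (Suc n))" "summable (\<lambda>n. L * (2 * d n))"
      using d by (simp_all add: summable_Suc_iff summable_mult)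
    show "norm (X (Suc n) - Z (Suc n)) \<le> d (Suc n)" for n
      unfolding X_def by (rule xbar_Z)
  qed (use L_pos f_Lip h H_Lip step_size W_eq e_le lower sub prox_le in \<open>auto simp: Z_def W_def\<close>)
  then have lim: "(\<lambda>n. norm (D (X (Suc n)) + (1 / \<alpha>) *\<^sub>R (W n - Z (Suc n)))) \<longlonglongrightarrow> 0"
    by (rule tendsto_norm_zero)

  define \<mu> where "\<mu> k = min_norm ((+) (D (xbar k)) ` eps_subdifferential (\<epsilon> k) h (xbar k))" for k
  \<comment> \<open>The residual at \<open>X (Suc n) = xbar (n + 3)\<close> lies in the translated
    \<open>\<epsilon>\<close>-subdifferential, because the proximal residual is an
    \<open>\<epsilon>\<close>-subgradient at the mean iterate.\<close>
  have \<mu>_le: "0 \<le> \<mu> (n + 3) \<and> \<mu> (n + 3) \<le> norm (D (X (Suc n)) + (1 / \<alpha>) *\<^sub>R (W n - Z (Suc n)))" for n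
  proof -
    define k where "k = n + 3"
    have k: "k \<ge> 2" "X (Suc n) = xbar k" "W n = vbar k" "Z (Suc n) = prox \<alpha> h (vbar k)"
      by (simp_all add: k_def X_def W_def Z_def eval_nat_numeral)
    have "(1 / \<alpha>) *\<^sub>R (vbar k - prox \<alpha> h (vbar k)) \<in> eps_subdifferential (\<epsilon> k) h (xbar k)"
      using prox_eps_subgradient[OF h step_size(1) sub H_Lip] error k(1) by simp
    moreover have "closed ((+) (D (xbar k)) ` eps_subdifferential (\<epsilon> k) h (xbar k))"
      by (intro closed_translation closed_eps_subdifferential[OF h])
    ultimately show ?thesis
      unfolding k k_def[symmetric] \<mu>_def using min_norm_le by blast
  qed
  have "(\<lambda>n. \<mu> (n + 3)) \<longlonglongrightarrow> 0"
    by (rule tendsto_sandwich[OF _ _ tendsto_const lim]) (use \<mu>_le in auto)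
  then have "\<mu> \<longlonglongrightarrow> 0" by (rule LIMSEQ_offset)
  then show ?thesis unfolding \<mu>_def grad_f .
qed

end
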